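(* Let $\mathcal{K}$ be a Krein space, $\mathcal{H}$ a Hilbert space, and let $\Gamma:\mathcal{K}^2\to\mathcal{H}^2$ be a Green's boundary relation. Consider the condition (U): for every $(\hat g,\hat k)\in\mathcal{K}^2\times\mathcal{H}^2$, if $[\hat f,\hat g]_{\mathcal{K}^2}=[\hat h,\hat k]_{\mathcal{H}^2}$ for all $(\hat f,\hat h)\in\Gamma$, then $(\hat g,\hat k)\in\Gamma$. Then: (i) $\Gamma$ is a unitary relation, i.e. $\Gamma^{-1}=\Gamma^*$, if and only if $\Gamma$ satisfies (U). (ii) If (U) holds, then $(\operatorname{dom}\Gamma)^{[\perp]_{\mathcal{K}^2}}\subseteq\operatorname{dom}\Gamma$. (iii) If $\Gamma$ is a unitary boundary relation, then $M=N=S$ and $\tilde M=\tilde N=\tilde S$, where $M:=\operatorname{dom}\Gamma\cap(\operatorname{dom}\Gamma)^{[\perp]_{\mathcal{K}^2}}$, $N:=\ker\Gamma$, $S:=(\operatorname{dom}\Gamma)^+$, and $\tilde M:=\operatorname{ran}\Gamma\cap(\operatorname{ran}\Gamma)^{[\perp]_{\mathcal{H}^2}}$, $\tilde N:=\operatorname{mul}\Gamma$, $\tilde S:=(\operatorname{ran}\Gamma)^+$.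
   Context: Let $(\mathcal{K},[\cdot,\cdot])$ be a complex Krein space and $(\mathcal{H},(\cdot,\cdot))$ a Hilbert space. Elements of $\mathcal{K}^2$ are written $\hat f=(f,f')$, $\hat g=(g,g')$, and elements of $\mathcal{H}^2$ are written $\hat h=(h,h')$, $\hat k=(k,k')$. Inner products are linear in the first argument. $\mathcal{K}^2$ and $\mathcal{H}^2$ are Krein spaces with the inner products $[\hat f,\hat g]_{\mathcal{K}^2}=-i[f',g]+i[f,g']$ and $[\hat h,\hat k]_{\mathcal{H}^2}=-i(h',k)+i(h,k')$; $[\perp]_{\mathcal{K}^2}$ and $[\perp]_{\mathcal{H}^2}$ denote orthogonal companions with respect to these. A linear relation $T:X\to Y$ is a linear subspace $T\subseteq X\times Y$, with the usual $\operatorname{dom}T$, $\operatorname{ran}T$, $\ker T=\{x:(x,0)\in T\}$, $\operatorname{mul}T=\{y:(0,y)\in T\}$, $T^{-1}=\{(y,x):(x,y)\in T\}$; for Krein spaces $X,Y$, $T^*=\{(k,h)\in Y\times X:[f,h]_X=[g,k]_Y\ \forall(f,g)\in T\}$. For a linear subspace $T\subseteq\mathcal{K}^2$ (resp. $\mathcal{H}^2$), viewed as a linear relation in $\mathcal{K}$ (resp. $\mathcal{H}$), $T^+$ denotes its adjoint, which equals $T^{[\perp]_{\mathcal{K}^2}}$ (resp. $T^{[\perp]_{\mathcal{H}^2}}$). A Green's boundary relation is a linear relation $\Gamma\subseteq\mathcal{K}^2\times\mathcal{H}^2$ such that $[f',g]-[f,g']=(h',k)-(h,k')$ for all $(\hat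 f,\hat h),(\hat g,\hat k)\in\Gamma$, equivalently $[\hat f,\hat g]_{\mathcal{K}^2}=[\hat h,\hat k]_{\mathcal{H}^2}$ for all such pairs. It is called a unitary boundary relation if $\Gamma^{-1}=\Gamma^*$, where $\Gamma^*$ is taken between the Krein spaces $(\mathcal{K}^2,[\cdot,\cdot]_{\mathcal{K}^2})$ and $(\mathcal{H}^2,[\cdot,\cdot]_{\mathcal{H}^2})$. *)

theory Defs
  imports "HOL-Analysis.Analysis"
begin

text \<open>The scalar multiplication is a parameter because there is no type class of complex vector
  spaces. All inner products are linear in the first argument.\<close>

locale hermitian_space = vector_space smul
  for smul :: "complex \<Rightarrow> 'a::ab_group_add \<Rightarrow> 'a" +
  fixes ip :: "'a \<Rightarrow> 'a \<Rightarrow> complex"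
  assumes ip_add_left: "ip (x + y) z = ip x z + ip y z"
    and ip_scale_left: "ip (smul c x) z = c * ip x z"
    and ip_hermitian: "ip y x = cnj (ip x y)"

text \<open>Only used for Hermitian forms, for which \<open>ip x x\<close> is real, so that taking \<open>Re\<close> loses nothing.\<close>

definition hilbert_subspace ::
    "(complex \<Rightarrow> 'a::ab_group_add \<Rightarrow> 'a) \<Rightarrow> ('a \<Rightarrow> 'a \<Rightarrow> complex) \<Rightarrow> 'a set \<Rightarrow> bool" where
  "hilbert_subspace smul ip X \<longleftrightarrow>
     module.subspace smul X \<and>
     (\<forall>x\<in>X. x \<noteq> 0 \<longrightarrow> 0 < Re (ip x x)) \<and>
     Metric_space.mcomplete X (\<lambda>x y. sqrt (Re (ip (x - y) (x - y))))"

locale hilbert_space = hermitian_space +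
  assumes hilbert: "hilbert_subspace smul ip UNIV"

text \<open>A Krein space is a Hermitian space with a fundamental decomposition: an orthogonal direct sum
  of a Hilbert space and an anti-Hilbert space. Only its existence is required; no particular
  decomposition is part of the structure.\<close>

locale krein_space = hermitian_space +
  assumes fundamental_decomposition:
    "\<exists>P N. hilbert_subspace smul ip P \<and>
           hilbert_subspace smul (\<lambda>x y. - ip x y) N \<and>
           (\<forall>x\<in>P. \<forall>y\<in>N. ip x y = 0) \<and>
           P \<inter> N = {0} \<and>
           (\<forall>z. \<exists>x\<in>P. \<exists>y\<in>N. z = x + y)"

definition boundary_form :: "('a \<Rightarrow> 'a \<Rightarrow> complex) \<Rightarrow> 'a \<times> 'a \<Rightarrow> 'a \<times> 'a \<Rightarrow> complex" where
  "boundary_form ip u v = - \<i> * ip (snd u) (fst v) + \<i> * ip (fst u) (snd v)"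

definition orth_companion :: "('x \<Rightarrow> 'x \<Rightarrow> complex) \<Rightarrow> 'x set \<Rightarrow> 'x set" where
  "orth_companion form L = {v. \<forall>u\<in>L. form u v = 0}"

definition linear_relation ::
    "(complex \<Rightarrow> 'x::ab_group_add \<Rightarrow> 'x) \<Rightarrow> (complex \<Rightarrow> 'y::ab_group_add \<Rightarrow> 'y) \<Rightarrow> ('x \<times> 'y) set \<Rightarrow> bool" where
  "linear_relation sX sY T \<longleftrightarrow> module.subspace (module_prod.scale sX sY) T"

definition rel_ker :: "('x \<times> 'y::zero) set \<Rightarrow> 'x set" where
  "rel_ker T = {x. (x, 0) \<in> T}"

definition rel_mul :: "('x::zero \<times> 'y) set \<Rightarrow> 'y set" where
  "rel_mul T = {y. (0, y) \<in> T}"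

definition rel_adjoint ::
    "('x \<Rightarrow> 'x \<Rightarrow> complex) \<Rightarrow> ('y \<Rightarrow> 'y \<Rightarrow> complex) \<Rightarrow> ('x \<times> 'y) set \<Rightarrow> ('y \<times> 'x) set" where
  "rel_adjoint ipX ipY T = {(k, h). \<forall>(f, g)\<in>T. ipX f h = ipY g k}"

definition unitary_relation ::
    "('x \<Rightarrow> 'x \<Rightarrow> complex) \<Rightarrow> ('y \<Rightarrow> 'y \<Rightarrow> complex) \<Rightarrow> ('x \<times> 'y) set \<Rightarrow> bool" where
  "unitary_relation ipX ipY T \<longleftrightarrow> T\<inverse> = rel_adjoint ipX ipY T"

definition greens_boundary_relation ::
    "(complex \<Rightarrow> 'k::ab_group_add \<Rightarrow> 'k) \<Rightarrow> ('k \<Rightarrow> 'k \<Rightarrow> complex) \<Rightarrow>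
     (complex \<Rightarrow> 'h::ab_group_add \<Rightarrow> 'h) \<Rightarrow> ('h \<Rightarrow> 'h \<Rightarrow> complex) \<Rightarrow>
     (('k \<times> 'k) \<times> ('h \<times> 'h)) set \<Rightarrow> bool" where
  "greens_boundary_relation sK ipK sH ipH \<Gamma> \<longleftrightarrow>
     linear_relation (module_prod.scale sK sK) (module_prod.scale sH sH) \<Gamma> \<and>
     (\<forall>((f, f'), (h, h'))\<in>\<Gamma>. \<forall>((g, g'), (k, k'))\<in>\<Gamma>.
        ipK f' g - ipK f g' = ipH h' k - ipH h k')"

definition unitary_boundary_relation ::
    "(complex \<Rightarrow> 'k::ab_group_add \<Rightarrow> 'k) \<Rightarrow> ('k \<Rightarrow> 'k \<Rightarrow> complex) \<Rightarrow>
     (complex \<Rightarrow> 'h::ab_group_add \<Rightarrow> 'h) \<Rightarrow> ('h \<Rightarrow> 'h \<Rightarrow> complex) \<Rightarrow>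
     (('k \<times> 'k) \<times> ('h \<times> 'h)) set \<Rightarrow> bool" where
  "unitary_boundary_relation sK ipK sH ipH \<Gamma> \<longleftrightarrow>
     greens_boundary_relation sK ipK sH ipH \<Gamma> \<and>
     unitary_relation (boundary_form ipK) (boundary_form ipH) \<Gamma>"

definition condition_U ::
    "('k \<Rightarrow> 'k \<Rightarrow> complex) \<Rightarrow> ('h \<Rightarrow> 'h \<Rightarrow> complex) \<Rightarrow> (('k \<times> 'k) \<times> ('h \<times> 'h)) set \<Rightarrow> bool" where
  "condition_U ipK ipH \<Gamma> \<longleftrightarrow>
     (\<forall>g k. (\<forall>(f, h)\<in>\<Gamma>. boundary_form ipK f g = boundary_form ipH h k) \<longrightarrow> (g, k) \<in> \<Gamma>)"

end

theory Submission
  imports Defs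
begin

text \<open>The Green identity says that \<open>\<Gamma>\<close> is isometric for the two boundary forms, which is the inclusion
  \<open>\<Gamma>\<inverse> \<subseteq> \<Gamma>\<^sup>*\<close>. Condition (U) says that every pair satisfying the defining property of the adjoint,
  with its components swapped, lies in \<open>\<Gamma>\<close>; this is the opposite inclusion \<open>\<Gamma>\<^sup>* \<subseteq> \<Gamma>\<inverse>\<close>. Hence (U) is
  unitarity.

  The other parts come from testing (U) on pairs with a zero component. For such a pair \<open>(g, 0)\<close>
  the condition in (U) says that \<open>g\<close> is orthogonal to \<open>dom \<Gamma>\<close>, so (U) gives
  \<open>(dom \<Gamma>)\<^sup>\<bottom> \<subseteq> ker \<Gamma>\<close>; isometry gives the converse inclusion, and since
  \<open>ker \<Gamma> \<subseteq> dom \<Gamma>\<close> the kernel is also \<open>dom \<Gamma> \<inter> (dom \<Gamma>)\<^sup>\<bottom>\<close>. The pairs \<open>(0, k)\<close>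
  do the same for \<open>ran \<Gamma>\<close> and \<open>mul \<Gamma>\<close>. Finally, for the boundary form the orthogonal companion of a
  subset is its adjoint as a relation.\<close>

definition isometric_relation ::
    "('x \<Rightarrow> 'x \<Rightarrow> complex) \<Rightarrow> ('y \<Rightarrow> 'y \<Rightarrow> complex) \<Rightarrow> ('x \<times> 'y) set \<Rightarrow> bool" where
  "isometric_relation B C T \<longleftrightarrow> (\<forall>(f, h)\<in>T. \<forall>(g, k)\<in>T. B f g = C h k)"

lemma isometric_relationD:
  assumes "isometric_relation B C T" and "(f, h) \<in> T" and "(g, k) \<in> T"
  shows "B f g = C h k"
  using assms unfolding isometric_relation_def by blast

lemma (in hermitian_space) ip_zero_left: "ip 0 z = 0"
  using ip_add_left[of 0 0 z] by simp

lemma (in hermitian_space) ip_zero_right: "ip z 0 = 0"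
  using ip_hermitian[of z 0] by (simp add: ip_zero_left)

lemma (in hermitian_space) boundary_form_zero_right: "boundary_form ip u 0 = 0"
  by (simp add: boundary_form_def ip_zero_right)

text \<open>The factor \<open>- \<i>\<close>, which makes the boundary form Hermitian, can be cancelled. This turns equalities
  of boundary forms into the Green identity and, when the form is zero, into the defining equation
  of the adjoint.\<close>

lemma boundary_form_eq_neg_i_times:
  "boundary_form ip u v = - \<i> * (ip (snd u) (fst v) - ip (fst u) (snd v))"
  by (simp add: boundary_form_def algebra_simps)

lemma rel_adjoint_eq_orth_companion:
  "rel_adjoint ip ip L = orth_companion (boundary_form ip) L"
  by (auto simp: rel_adjoint_def orth_companion_def boundary_form_eq_neg_i_times
      case_prod_unfold)

lemma greens_boundary_relation_isometric:
  assumes "greens_boundary_relation sK ipK sH ipH \<Gamma>"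
  shows "isometric_relation (boundary_form ipK) (boundary_form ipH) \<Gamma>"
  unfolding isometric_relation_def
proof (clarify)
  fix f f' h h' g g' k k'
  assume "((f, f'), (h, h')) \<in> \<Gamma>" and "((g, g'), (k, k')) \<in> \<Gamma>"
  then have "ipK f' g - ipK f g' = ipH h' k - ipH h k'"
    using assms unfolding greens_boundary_relation_def by blast
  then show "boundary_form ipK (f, f') (g, g') = boundary_form ipH (h, h') (k, k')"
    by (simp add: boundary_form_eq_neg_i_times)
qed

lemma unitary_iff_condition_U:
  assumes "isometric_relation (boundary_form ipK) (boundary_form ipH) \<Gamma>"
  shows "unitary_relation (boundary_form ipK) (boundary_form ipH) \<Gamma> \<longleftrightarrow> condition_U ipK ipH \<Gamma>"
proof -
  have "\<Gamma>\<inverse> \<subseteq> rel_adjoint (boundary_form ipK) (boundary_form ipH) \<Gamma>"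
    using isometric_relationD[OF assms] by (auto simp: rel_adjoint_def)
  moreover have "rel_adjoint (boundary_form ipK) (boundary_form ipH) \<Gamma> \<subseteq> \<Gamma>\<inverse>
      \<longleftrightarrow> condition_U ipK ipH \<Gamma>"
    unfolding rel_adjoint_def condition_U_def by blast
  ultimately show ?thesis
    unfolding unitary_relation_def by blast
qed

lemma isometric_ker_subset_orth_dom:
  assumes "isometric_relation B C T" and "\<And>y. C y 0 = 0"
  shows "rel_ker T \<subseteq> orth_companion B (Domain T)"
proof
  fix g assume "g \<in> rel_ker T"
  then have g: "(g, 0) \<in> T"
    by (simp add: rel_ker_def)
  have "B f g = 0" if "(f, h) \<in> T" for f h
    using isometric_relationD[OF assms(1) that g] assms(2) by simp
  then show "g \<in> orth_companion B (Domain T)"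
    by (auto simp: orth_companion_def)
qed

lemma isometric_mul_subset_orth_ran:
  assumes "isometric_relation B C T" and "\<And>x. B x 0 = 0"
  shows "rel_mul T \<subseteq> orth_companion C (Range T)"
proof
  fix k assume "k \<in> rel_mul T"
  then have k: "(0, k) \<in> T"
    by (simp add: rel_mul_def)
  have "C h k = 0" if "(f, h) \<in> T" for f h
    using isometric_relationD[OF assms(1) that k] assms(2) by simp
  then show "k \<in> orth_companion C (Range T)"
    by (auto simp: orth_companion_def)
qed

text \<open>A vector \<open>g\<close> orthogonal to the domain makes \<open>(g, 0)\<close> satisfy the premise of (U), both sides of
  the identity being zero.\<close>

lemma condition_U_orth_dom_subset_ker:
  assumes "condition_U ipK ipH \<Gamma>" and "\<And>y. boundary_form ipH y 0 = 0"
  shows "orth_companion (boundary_form ipK) (Domain \<Gamma>) \<subseteq> rel_ker \<Gamma>"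
proof
  fix g assume "g \<in> orth_companion (boundary_form ipK) (Domain \<Gamma>)"
  then have "\<forall>(f, h)\<in>\<Gamma>. boundary_form ipK f g = boundary_form ipH h 0"
    by (auto simp: orth_companion_def assms(2))
  then show "g \<in> rel_ker \<Gamma>"
    using assms(1) unfolding condition_U_def rel_ker_def by blast
qed

lemma condition_U_orth_ran_subset_mul:
  assumes "condition_U ipK ipH \<Gamma>" and "\<And>x. boundary_form ipK x 0 = 0"
  shows "orth_companion (boundary_form ipH) (Range \<Gamma>) \<subseteq> rel_mul \<Gamma>"
proof
  fix k assume "k \<in> orth_companion (boundary_form ipH) (Range \<Gamma>)"
  then have "\<forall>(f, h)\<in>\<Gamma>. boundary_form ipK f 0 = boundary_form ipH h k"
    by (auto simp: orth_companion_def assms(2))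
  then show "k \<in> rel_mul \<Gamma>"
    using assms(1) unfolding condition_U_def rel_mul_def by blast
qed

lemma rel_ker_subset_Domain: "rel_ker T \<subseteq> Domain T"
  unfolding rel_ker_def by blast

lemma rel_mul_subset_Range: "rel_mul T \<subseteq> Range T"
  unfolding rel_mul_def by blast

theorem proposition5p4:
  fixes scaleK :: "complex \<Rightarrow> 'k::ab_group_add \<Rightarrow> 'k"
    and ipK :: "'k \<Rightarrow> 'k \<Rightarrow> complex"
    and scaleH :: "complex \<Rightarrow> 'h::ab_group_add \<Rightarrow> 'h"
    and ipH :: "'h \<Rightarrow> 'h \<Rightarrow> complex"
    and \<Gamma> :: "(('k \<times> 'k) \<times> ('h \<times> 'h)) set"
  assumes "krein_space scaleK ipK"
    and "hilbert_space scaleH ipH"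
    and "greens_boundary_relation scaleK ipK scaleH ipH \<Gamma>"
  shows "(unitary_relation (boundary_form ipK) (boundary_form ipH) \<Gamma> \<longleftrightarrow> condition_U ipK ipH \<Gamma>) \<and>
    (condition_U ipK ipH \<Gamma> \<longrightarrow> orth_companion (boundary_form ipK) (Domain \<Gamma>) \<subseteq> Domain \<Gamma>) \<and>
    (unitary_boundary_relation scaleK ipK scaleH ipH \<Gamma> \<longrightarrow>
      (let M = Domain \<Gamma> \<inter> orth_companion (boundary_form ipK) (Domain \<Gamma>);
           N = rel_ker \<Gamma>;
           S = rel_adjoint ipK ipK (Domain \<Gamma>);
           M' = Range \<Gamma> \<inter> orth_companion (boundary_form ipH) (Range \<Gamma>);
           N' = rel_mul \<Gamma>;
           S' = rel_adjoint ipH ipH (Range \<Gamma>)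
       in M = N \<and> N = S \<and> M' = N' \<and> N' = S'))"
proof -
  interpret K: krein_space scaleK ipK by fact
  interpret H: hilbert_space scaleH ipH by fact
  have iso: "isometric_relation (boundary_form ipK) (boundary_form ipH) \<Gamma>"
    using assms(3) by (rule greens_boundary_relation_isometric)
  note unitary = unitary_iff_condition_U[OF iso]
  have ker: "rel_ker \<Gamma> = orth_companion (boundary_form ipK) (Domain \<Gamma>)"
    if "condition_U ipK ipH \<Gamma>"
    using isometric_ker_subset_orth_dom[OF iso, OF H.boundary_form_zero_right]
      condition_U_orth_dom_subset_ker[OF that, OF H.boundary_form_zero_right] by (rule equalityI)
  have mul: "rel_mul \<Gamma> = orth_companion (boundary_form ipH) (Range \<Gamma>)"
    if "condition_U ipK ipH \<Gamma>"
    using isometric_mul_subset_orth_ran[OF iso, OF K.boundary_form_zero_right]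
      condition_U_orth_ran_subset_mul[OF that, OF K.boundary_form_zero_right] by (rule equalityI)
  have "orth_companion (boundary_form ipK) (Domain \<Gamma>) \<subseteq> Domain \<Gamma>"
    if "condition_U ipK ipH \<Gamma>"
    using ker[OF that] rel_ker_subset_Domain[of \<Gamma>] by blast
  moreover have "let M = Domain \<Gamma> \<inter> orth_companion (boundary_form ipK) (Domain \<Gamma>);
           N = rel_ker \<Gamma>;
           S = rel_adjoint ipK ipK (Domain \<Gamma>);
           M' = Range \<Gamma> \<inter> orth_companion (boundary_form ipH) (Range \<Gamma>);
           N' = rel_mul \<Gamma>;
           S' = rel_adjoint ipH ipH (Range \<Gamma>)
       in M = N \<and> N = S \<and> M' = N' \<and> N' = S'"
    if "unitary_boundary_relation scaleK ipK scaleH ipH \<Gamma>"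
  proof -
    have U: "condition_U ipK ipH \<Gamma>"
      using that unitary unfolding unitary_boundary_relation_def by blast
    show ?thesis
      unfolding Let_def rel_adjoint_eq_orth_companion
      using ker[OF U] mul[OF U] rel_ker_subset_Domain[of \<Gamma>] rel_mul_subset_Range[of \<Gamma>] by blast
  qed
  ultimately show ?thesis
    using unitary by blast
qed

end
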